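(* For all $v_1,\ldots,v_p\in\mathbb{C}^n$, $$\|v_1\wedge\cdots\wedge v_p\|^2=\|v_1\vartriangle\mathrm{i}v_1\vartriangle\cdots\vartriangle v_p\vartriangle\mathrm{i}v_p\|.$$
   Context: $\wedge$ is the $\mathbb{C}$-bilinear exterior product of the complex Grassmann (exterior) algebra $\bigwedge\mathbb{C}^n$, and $\vartriangle$ is the $\mathbb{R}$-bilinear exterior product of the real Grassmann algebra $\bigwedge(\mathbb{C}^n)_{\mathbb{R}}$, where $(\mathbb{C}^n)_{\mathbb{R}}=\mathbb{R}^{2n}$ is the underlying real space of $\mathbb{C}^n$. $\mathbb{C}^n$ has the canonical Hermitian product $\langle\cdot,\cdot\rangle$ (conjugate-linear in the first entry) and $(\mathbb{C}^n)_{\mathbb{R}}$ has the inner product $\langle\cdot,\cdot\rangle_{\mathbb{R}}=\operatorname{Re}\langle\cdot,\cdot\rangle$. Norms are those of the induced Hermitian/inner products on the exterior algebras, so that $\|v_1\wedge\cdots\wedge v_k\|=\sqrt{\det(\langle v_i,v_j\rangle)}$ and $\|v_1\vartriangle\cdots\vartriangle v_k\|=\sqrt{\det(\langle v_i,v_j\rangle_{\mathbb{R}})}$. *)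

theory Defs
  imports "HOL-Analysis.Analysis"
begin

text \<open>
  The Grassmann algebra of \<open>K\<^sup>n\<close> over the scalars \<open>K\<close>, in coordinates: with \<open>e\<^sub>i\<close> the canonical
  basis and \<open>I = {i\<^sub>1 < \<dots> < i\<^sub>k}\<close>, the entry at \<open>I\<close> is the coefficient of
  \<open>e\<^sub>I = e\<^bsub>i\<^sub>1\<^esub> \<and> \<dots> \<and> e\<^bsub>i\<^sub>k\<^esub>\<close>. The index type carries no order of its own, so an arbitrary total
  order is fixed through the injection \<^const>\<open>to_nat\<close>; another order only changes the signs of some
  basis elements \<open>e\<^sub>I\<close>.

  The library norm of this vector type is \<open>sqrt (\<Sum>\<^sub>I |x\<^sub>I|\<^sup>2)\<close>. It is the norm of the Hermitian (resp.
  Euclidean) product for which the \<open>e\<^sub>I\<close> are orthonormal, which is the product induced from the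
  canonical one of \<open>K\<^sup>n\<close>: different degrees are orthogonal and, since the \<open>e\<^sub>i\<close> are orthonormal, for
  \<open>I\<close>, \<open>J\<close> of equal size the determinant of the products of the factors of \<open>e\<^sub>I\<close> with those of \<open>e\<^sub>J\<close>
  is \<open>1\<close> if \<open>I = J\<close> and \<open>0\<close> otherwise.
\<close>

type_synonym ('k, 'i) grassmann = "'k ^ ('i set)"

text \<open>
  \<open>e\<^sub>I \<and> e\<^sub>J = shuffle_sign I J * e\<^bsub>I \<union> J\<^esub>\<close> for disjoint \<open>I\<close>, \<open>J\<close>: the exponent counts the
  transpositions needed to sort the concatenated factors.
\<close>

definition shuffle_sign :: "'i::finite set \<Rightarrow> 'i set \<Rightarrow> 'k::comm_ring_1" where
  "shuffle_sign I J = (- 1) ^ card {(i, j). i \<in> I \<and> j \<in> J \<and> to_nat j < to_nat i}"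

definition ext_mult ::
  "('k::comm_ring_1, 'i::finite) grassmann \<Rightarrow> ('k, 'i) grassmann \<Rightarrow> ('k, 'i) grassmann" where
  "ext_mult x y = (\<chi> K. \<Sum>I\<in>Pow K. shuffle_sign I (K - I) * (x $ I) * (y $ (K - I)))"

definition ext_one :: "('k::comm_ring_1, 'i::finite) grassmann" where
  "ext_one = axis {} 1"

definition ext_vec :: "'k::comm_ring_1 ^ 'i::finite \<Rightarrow> ('k, 'i) grassmann" where
  "ext_vec v = (\<Sum>i\<in>UNIV. axis {i} (v $ i))"

definition ext_prod :: "('k::comm_ring_1 ^ 'i::finite) list \<Rightarrow> ('k, 'i) grassmann" where
  "ext_prod vs = foldr (\<lambda>v x. ext_mult (ext_vec v) x) vs ext_one"

text \<open>
  The underlying real space of \<open>\<complex>\<^sup>n\<close> as \<open>\<real>\<^bsup>2n\<^esup>\<close>: coordinate \<open>Inl j\<close> belongs to \<open>e\<^sub>j\<close> and \<open>Inr j\<close> to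
  \<open>\<i> e\<^sub>j\<close>.
\<close>

definition realify :: "complex ^ 'n \<Rightarrow> real ^ ('n + 'n)" where
  "realify v = (\<chi> k. case k of Inl j \<Rightarrow> Re (v $ j) | Inr j \<Rightarrow> Im (v $ j))"

lemma linear_realify: "linear (realify :: complex ^ 'n::finite \<Rightarrow> _)"
  by (rule linearI) (auto simp: realify_def vec_eq_iff split: sum.split)

lemma bij_realify: "bij (realify :: complex ^ 'n::finite \<Rightarrow> _)"
proof (rule bijI')
  fix v w :: "complex ^ 'n"
  have "realify v = realify w \<Longrightarrow> v = w"
    unfolding realify_def vec_eq_iff
    by (intro allI complex_eqI)
      (metis (mono_tags, lifting) vec_lambda_beta sum.case(1), metis (mono_tags, lifting) vec_lambda_beta sum.case(2))
  then show "realify v = realify w \<longleftrightarrow> v = w" by blast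
next
  fix y :: "real ^ ('n + 'n)"
  have "y = realify (\<chi> j. Complex (y $ Inl j) (y $ Inr j))"
    by (auto simp: realify_def vec_eq_iff split: sum.split)
  then show "\<exists>v. y = realify v" ..
qed

lemma inner_realify:
  fixes v w :: "complex ^ 'n::finite"
  shows "realify v \<bullet> realify w = Re (\<Sum>j\<in>UNIV. cnj (v $ j) * w $ j)"
  by (simp add: inner_vec_def realify_def UNIV_Plus_UNIV[symmetric] sum.Plus sum.distrib
      del: UNIV_Plus_UNIV)

end

theory Submission
  imports Defs
begin

text \<open>
  Both sides are multiplied by the same factor when a vector is put in front of the list.
  Write \<open>v = y + z\<close> with \<open>y\<close> in the complex span of the vectors \<open>v\<^sub>1, \<dots>, v\<^sub>k\<close> already present and
  \<open>z\<close> Hermitian orthogonal to them. On the complex side \<open>y\<close> disappears from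
  \<open>v \<and> v\<^sub>1 \<and> \<dots> \<and> v\<^sub>k\<close> because a product with a repeated factor vanishes, and the orthogonal \<open>z\<close>
  multiplies the norm by \<open>\<parallel>z\<parallel>\<close>. On the real side the complex span of the \<open>v\<^sub>j\<close> is the real span of
  the \<open>v\<^sub>j\<close> and \<open>\<i>v\<^sub>j\<close>, so \<open>v\<close> and \<open>\<i>v\<close> may likewise be replaced by \<open>z\<close> and \<open>\<i>z\<close>. These two are
  orthogonal to each other and to everything else, and both have norm \<open>\<parallel>z\<parallel>\<close>; so the real norm is
  multiplied by \<open>\<parallel>z\<parallel>\<^sup>2\<close>, exactly as the square of the complex norm.
  
  The analytic input is therefore only that an orthogonal factor multiplies the norm
  (\<open>norm_wedge_orthogonal_complex\<close>, \<open>norm_wedge_orthogonal_real\<close>). Both follow, without any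
  determinant, from the contraction by a covector \<open>a\<close>, which is adjoint to the multiplication by \<open>a\<close>
  (\<open>scalar_product_wedge_left\<close>) and is an antiderivation (\<open>contraction_wedge\<close>). These two facts are
  stated for a bilinear pairing over an arbitrary commutative ring, so that the real and the complex
  case share one proof; the Hermitian product enters by conjugating one argument.
\<close>

section \<open>Exterior multiplication by a vector\<close>

lemma shuffle_sign_singleton:
  "shuffle_sign {i} J = (- 1) ^ card {j \<in> J. to_nat j < to_nat i}"
proof -
  have "{(i', j). i' \<in> {i} \<and> j \<in> J \<and> to_nat j < to_nat i'} = Pair i ` {j \<in> J. to_nat j < to_nat i}"
    by auto
  then show ?thesis
    by (simp add: shuffle_sign_def card_image inj_on_def)
qed

lemma shuffle_sign_insert:
  assumes "k \<notin> J"
  shows "shuffle_sign {i} (insert k J) =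
    (if to_nat k < to_nat i then - shuffle_sign {i} J else shuffle_sign {i} J)"
proof -
  have "{j \<in> insert k J. to_nat j < to_nat i} =
    (if to_nat k < to_nat i then insert k {j \<in> J. to_nat j < to_nat i} else {j \<in> J. to_nat j < to_nat i})"
    by auto
  then show ?thesis
    using assms by (simp add: shuffle_sign_singleton)
qed

lemma shuffle_sign_square [simp]: "shuffle_sign I J * shuffle_sign I J = 1"
  by (simp add: shuffle_sign_def flip: power_mult_distrib)

text \<open>
  Exactly one of \<open>i\<close>, \<open>k\<close> precedes the other, so exactly one of the two factors on the left changes
  sign when the additional index is removed. This is the sign in the antiderivation rule for
  contractions.
\<close>

lemma shuffle_sign_exchange:
  assumes "i \<notin> J" "k \<notin> J" "i \<noteq> k"
  shows "shuffle_sign {i} (insert k J) * shuffle_sign {k} (insert i J) =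
    - (shuffle_sign {i} J * shuffle_sign {k} J)"
  using assms by (auto simp: shuffle_sign_insert dest: not_less_iff_gr_or_eq[THEN iffD1])

lemma ext_vec_nth_singleton: "ext_vec v $ {i} = v $ i"
  by (simp add: ext_vec_def axis_def)

lemma ext_vec_nth_eq_0:
  assumes "\<And>i. I \<noteq> {i}"
  shows "ext_vec v $ I = 0"
  using assms by (simp add: ext_vec_def axis_def)

abbreviation wedge ::
  "'k::comm_ring_1 ^ 'i::finite \<Rightarrow> ('k, 'i) grassmann \<Rightarrow> ('k, 'i) grassmann" where
  "wedge v x \<equiv> ext_mult (ext_vec v) x"

text \<open>
  A vector has entries only at singletons, so the sum over all splittings of \<open>K\<close> becomes a sum over
  the elements of \<open>K\<close>.
\<close>

lemma wedge_nth:
  "wedge v x $ K = (\<Sum>i\<in>K. shuffle_sign {i} (K - {i}) * v $ i * x $ (K - {i}))"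
proof -
  have "wedge v x $ K = (\<Sum>I\<in>Pow K. shuffle_sign I (K - I) * ext_vec v $ I * x $ (K - I))"
    by (simp add: ext_mult_def)
  also have "\<dots> = (\<Sum>I\<in>(\<lambda>i. {i}) ` K. shuffle_sign I (K - I) * ext_vec v $ I * x $ (K - I))"
  proof (rule sum.mono_neutral_right)
    show "\<forall>I\<in>Pow K - (\<lambda>i. {i}) ` K. shuffle_sign I (K - I) * ext_vec v $ I * x $ (K - I) = 0"
    proof
      fix I assume "I \<in> Pow K - (\<lambda>i. {i}) ` K"
      then have "I \<noteq> {i}" for i by auto
      then show "shuffle_sign I (K - I) * ext_vec v $ I * x $ (K - I) = 0"
        by (simp add: ext_vec_nth_eq_0)
    qed
  qed auto
  also have "\<dots> = (\<Sum>i\<in>K. shuffle_sign {i} (K - {i}) * v $ i * x $ (K - {i}))"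
    by (subst sum.reindex) (auto simp: ext_vec_nth_singleton)
  finally show ?thesis .
qed

lemma wedge_add_left: "wedge (v + w) x = wedge v x + wedge w x"
  by (simp add: vec_eq_iff wedge_nth algebra_simps sum.distrib)

lemma wedge_zero_right: "wedge v 0 = 0"
  by (simp add: vec_eq_iff wedge_nth)

text \<open>
  Both sides are sums over ordered pairs of distinct indices \<open>i\<close>, \<open>k\<close> removed from \<open>K\<close>; removing them
  in the other order costs one transposition.
\<close>

lemma wedge_anticommute: "wedge u (wedge w x) = - wedge w (wedge u x)"
proof -
  have "wedge u (wedge w x) $ K = - wedge w (wedge u x) $ K" for K
  proof -
    define f where "f u w i k = shuffle_sign {i} (K - {i}) * shuffle_sign {k} (K - {i} - {k}) *
      u $ i * w $ k * x $ (K - {i} - {k})" for u w and i k :: 'b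
    have expand: "wedge u (wedge w x) $ K = (\<Sum>i\<in>K. \<Sum>k\<in>K - {i}. f u w i k)" for u w
      by (simp add: wedge_nth f_def sum_distrib_left mult_ac)
    have antisym: "f u w i k = - f w u k i" if "i \<in> K" "k \<in> K" "k \<noteq> i" for i k
    proof -
      define L where "L = K - {i} - {k}"
      have K: "K - {i} = insert k L" "K - {k} = insert i L" "K - {k} - {i} = L" "K - {i} - {k} = L"
        and L: "i \<notin> L" "k \<notin> L" "i \<noteq> k"
        using that by (auto simp: L_def)
      have f: "f u w i k = shuffle_sign {i} (insert k L) * shuffle_sign {k} L * (u $ i * w $ k * x $ L)"
        "f w u k i = shuffle_sign {k} (insert i L) * shuffle_sign {i} L * (u $ i * w $ k * x $ L)"
        unfolding f_def K(3,4) unfolding K(1,2) by (simp_all add: mult_ac)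
      have "shuffle_sign {i} (insert k L) * shuffle_sign {k} L =
          - (shuffle_sign {k} (insert i L) * shuffle_sign {i} L :: 'a)"
        using L by (auto simp: shuffle_sign_insert dest: not_less_iff_gr_or_eq[THEN iffD1])
      then show ?thesis
        unfolding f by simp
    qed
    have "wedge u (wedge w x) $ K = (\<Sum>i\<in>K. \<Sum>k | k \<in> K \<and> k \<noteq> i. - f w u k i)"
      unfolding expand by (intro sum.cong antisym) auto
    also have "\<dots> = (\<Sum>k\<in>K. \<Sum>i | i \<in> K \<and> k \<noteq> i. - f w u k i)"
      by (rule sum.swap_restrict) auto
    also have "\<dots> = - wedge w (wedge u x) $ K"
      unfolding expand sum_negf by (intro arg_cong[where f = uminus] sum.cong) auto
    finally show ?thesis .
  qed
  then show ?thesis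
    by (simp add: vec_eq_iff)
qed

text \<open>
  Anticommutation says that the square equals its own negative, whence the restriction to rings in
  which \<open>2\<close> can be cancelled.
\<close>

lemma wedge_wedge_self:
  fixes w :: "'k::{idom, ring_char_0} ^ 'i::finite"
  shows "wedge w (wedge w x) = 0"
proof -
  have "a = 0" if "a = - a" for a :: 'k
  proof -
    have "2 * a = 0" using that by (simp add: eq_neg_iff_add_eq_0)
    then show ?thesis by simp
  qed
  then show ?thesis
    using wedge_anticommute[of w w x] by (simp add: vec_eq_iff)
qed

lemma ext_prod_Nil [simp]: "ext_prod [] = ext_one"
  and ext_prod_Cons [simp]: "ext_prod (v # vs) = wedge v (ext_prod vs)"
  by (simp_all add: ext_prod_def)

text \<open>
  A repeated factor is moved past the others by anticommutation until it meets its copy.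
\<close>

lemma wedge_ext_prod_member:
  fixes w :: "'k::{idom, ring_char_0} ^ 'i::finite"
  assumes "w \<in> set vs"
  shows "wedge w (ext_prod vs) = 0"
  using assms
proof (induction vs)
  case (Cons v vs)
  show ?case
  proof (cases "w = v")
    case True
    then show ?thesis by (simp add: wedge_wedge_self)
  next
    case False
    then have "wedge w (ext_prod vs) = 0" using Cons by simp
    then show ?thesis
      using wedge_anticommute[of w v "ext_prod vs"] by (simp add: wedge_zero_right)
  qed
qed simp

section \<open>Contraction by a covector\<close>

text \<open>
  The interior product with \<open>a\<close>, read as the linear form \<open>scalar_product a\<close>.
\<close>

definition contraction ::
  "'k::comm_ring_1 ^ 'i::finite \<Rightarrow> ('k, 'i) grassmann \<Rightarrow> ('k, 'i) grassmann" where
  "contraction a y = (\<chi> J. \<Sum>i\<in>- J. shuffle_sign {i} J * a $ i * y $ insert i J)"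

text \<open>
  Both sides run over the pairs \<open>J\<close>, \<open>insert i J\<close> with \<open>i \<notin> J\<close>: the product with \<open>a\<close> goes up from \<open>J\<close>,
  the contraction comes down from \<open>insert i J\<close>, with the same coefficient.
\<close>

lemma scalar_product_wedge_left: "scalar_product (wedge a x) y = scalar_product x (contraction a y)"
proof -
  have "scalar_product (wedge a x) y = (\<Sum>K\<in>UNIV. \<Sum>i\<in>K. shuffle_sign {i} (K - {i}) * a $ i * x $ (K - {i}) * y $ K)"
    by (simp add: scalar_product_def wedge_nth sum_distrib_right)
  also have "\<dots> = (\<Sum>(K, i)\<in>Sigma UNIV (\<lambda>K. K). shuffle_sign {i} (K - {i}) * a $ i * x $ (K - {i}) * y $ K)"
    by (rule sum.Sigma) auto
  also have "\<dots> = (\<Sum>(J, i)\<in>Sigma UNIV (\<lambda>J. - J). shuffle_sign {i} J * a $ i * x $ J * y $ insert i J)"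
    by (rule sum.reindex_bij_witness[where j = "\<lambda>(K, i). (K - {i}, i)" and i = "\<lambda>(J, i). (insert i J, i)"])
      (auto simp: insert_absorb)
  also have "\<dots> = (\<Sum>J\<in>UNIV. \<Sum>i\<in>- J. shuffle_sign {i} J * a $ i * x $ J * y $ insert i J)"
    by (rule sum.Sigma[symmetric]) auto
  also have "\<dots> = scalar_product x (contraction a y)"
    by (simp add: scalar_product_def contraction_def sum_distrib_left mult_ac)
  finally show ?thesis .
qed

text \<open>
  The antiderivation rule. Inserting \<open>i\<close> and removing \<open>k\<close> gives \<open>scalar_product a w *s x\<close> when
  \<open>i = k\<close>, split according to whether this index lies in \<open>J\<close>. When \<open>i \<noteq> k\<close>, the terms
  \<open>g i k\<close> below occur in the two orders of the operations with opposite signs and cancel.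
\<close>

lemma contraction_wedge: "contraction a (wedge w x) = scalar_product a w *s x - wedge w (contraction a x)"
proof -
  have "contraction a (wedge w x) $ J + wedge w (contraction a x) $ J = scalar_product a w * x $ J" for J
  proof -
    define g where "g i k = shuffle_sign {i} (J - {k}) * shuffle_sign {k} (J - {k}) *
      a $ i * w $ k * x $ insert i (J - {k})" for i k
    have "contraction a (wedge w x) $ J = (\<Sum>i\<in>- J. a $ i * w $ i * x $ J - (\<Sum>k\<in>J. g i k))"
      unfolding contraction_def vec_lambda_beta
    proof (rule sum.cong[OF refl])
      fix i assume "i \<in> - J"
      then have i: "i \<notin> J" by simp
      have "shuffle_sign {i} J * a $ i * wedge w x $ insert i J =
          (shuffle_sign {i} J * shuffle_sign {i} J) * (a $ i * w $ i * x $ J) +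
          (\<Sum>k\<in>J. shuffle_sign {i} J * shuffle_sign {k} (insert i J - {k}) *
            a $ i * w $ k * x $ (insert i J - {k}))"
        using i by (simp add: wedge_nth algebra_simps sum_distrib_left del: shuffle_sign_square)
      also have "(\<Sum>k\<in>J. shuffle_sign {i} J * shuffle_sign {k} (insert i J - {k}) *
            a $ i * w $ k * x $ (insert i J - {k})) = (\<Sum>k\<in>J. - g i k)"
      proof (rule sum.cong[OF refl])
        fix k assume k: "k \<in> J"
        have eq: "insert i J - {k} = insert i (J - {k})" and J: "insert k (J - {k}) = J"
          using i k by auto
        have "shuffle_sign {i} J * shuffle_sign {k} (insert i (J - {k})) =
            - (shuffle_sign {i} (J - {k}) * shuffle_sign {k} (J - {k}) :: 'a)"
          using shuffle_sign_exchange[of i "J - {k}" k] i k by (metis J DiffD1 DiffD2 insertI1)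
        then show "shuffle_sign {i} J * shuffle_sign {k} (insert i J - {k}) *
            a $ i * w $ k * x $ (insert i J - {k}) = - g i k"
          by (simp add: eq g_def)
      qed
      finally show "shuffle_sign {i} J * a $ i * wedge w x $ insert i J =
          a $ i * w $ i * x $ J - (\<Sum>k\<in>J. g i k)"
        by (simp add: sum_negf)
    qed
    moreover have "wedge w (contraction a x) $ J = (\<Sum>k\<in>J. a $ k * w $ k * x $ J + (\<Sum>i\<in>- J. g i k))"
      unfolding wedge_nth
    proof (rule sum.cong[OF refl])
      fix k assume k: "k \<in> J"
      have compl: "- (J - {k}) = insert k (- J)" and J: "insert k (J - {k}) = J"
        using k by auto
      have "shuffle_sign {k} (J - {k}) * w $ k * contraction a x $ (J - {k}) =
          (shuffle_sign {k} (J - {k}) * shuffle_sign {k} (J - {k})) * (a $ k * w $ k * x $ J) +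
          (\<Sum>i\<in>- J. g i k)"
        using k by (simp add: contraction_def compl J insert_absorb g_def algebra_simps sum_distrib_left
            del: shuffle_sign_square)
      then show "shuffle_sign {k} (J - {k}) * w $ k * contraction a x $ (J - {k}) =
          a $ k * w $ k * x $ J + (\<Sum>i\<in>- J. g i k)"
        by simp
    qed
    moreover have "scalar_product a w * x $ J = (\<Sum>i\<in>J. a $ i * w $ i * x $ J) + (\<Sum>i\<in>- J. a $ i * w $ i * x $ J)"
      unfolding scalar_product_def sum_distrib_right
      by (subst sum.union_disjoint[symmetric]) (auto intro: sum.cong)
    moreover have "(\<Sum>k\<in>J. \<Sum>i\<in>- J. g i k) = (\<Sum>i\<in>- J. \<Sum>k\<in>J. g i k)"
      by (rule sum.swap)
    ultimately show ?thesis
      by (simp add: sum.distrib sum_subtractf)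
  qed
  then show ?thesis
    by (simp add: vec_eq_iff eq_diff_eq)
qed

text \<open>
  By the antiderivation rule the contraction acts on one factor at a time, and it sends each factor
  to \<open>0\<close>.
\<close>

lemma contraction_ext_prod_eq_0:
  assumes "\<And>w. w \<in> set vs \<Longrightarrow> scalar_product a w = 0"
  shows "contraction a (ext_prod vs) = 0"
  using assms
proof (induction vs)
  case Nil
  then show ?case
    by (simp add: vec_eq_iff contraction_def ext_one_def axis_def)
next
  case (Cons v vs)
  then show ?case
    by (simp add: contraction_wedge wedge_zero_right)
qed

text \<open>
  Moved across the pairing, \<open>a\<close> contracts only with \<open>v\<close>. When \<open>y\<close> is itself a product, this is the
  Laplace expansion of a Gram determinant along a row whose only nonzero entry is the one for \<open>v\<close>.
\<close>

lemma scalar_product_wedge_wedge: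
  assumes "\<And>w. w \<in> set vs \<Longrightarrow> scalar_product a w = 0"
  shows "scalar_product (wedge a y) (wedge v (ext_prod vs)) = scalar_product a v * scalar_product y (ext_prod vs)"
  using contraction_ext_prod_eq_0[OF assms]
  by (simp add: scalar_product_wedge_left contraction_wedge wedge_zero_right)
    (simp add: scalar_product_def sum_distrib_left mult_ac)

section \<open>Orthogonal factors multiply the norm\<close>

definition cnj_vec :: "complex ^ 'i::finite \<Rightarrow> complex ^ 'i" where
  "cnj_vec x = (\<chi> i. cnj (x $ i))"

lemma scalar_product_cnj_vec_self: "scalar_product (cnj_vec x) x = of_real ((norm x)\<^sup>2)"
  by (simp add: scalar_product_def cnj_vec_def norm_vec_def L2_set_def sum_nonneg complex_norm_square mult.commute
      del: of_real_power)

lemma scalar_product_real_self: "scalar_product x x = (norm x)\<^sup>2" for x :: "real ^ 'i::finite"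
  by (simp add: scalar_product_def power2_norm_eq_inner inner_vec_def)

text \<open>
  The signs are real, so conjugation is a ring homomorphism of the Grassmann algebra; this carries
  the bilinear formula over to the Hermitian norm.
\<close>

lemma cnj_vec_wedge: "cnj_vec (wedge v x) = wedge (cnj_vec v) (cnj_vec x)"
proof -
  have "cnj (shuffle_sign I J) = shuffle_sign I J" for I J :: "'a set"
    by (simp add: shuffle_sign_def)
  then show ?thesis
    by (simp add: vec_eq_iff wedge_nth cnj_vec_def)
qed

lemma norm_wedge_orthogonal_complex:
  fixes v :: "complex ^ 'i::finite"
  assumes "\<And>w. w \<in> set vs \<Longrightarrow> scalar_product (cnj_vec v) w = 0"
  shows "norm (wedge v (ext_prod vs)) = norm v * norm (ext_prod vs)"
proof -
  have "complex_of_real ((norm (wedge v (ext_prod vs)))\<^sup>2) =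
      of_real ((norm v)\<^sup>2 * (norm (ext_prod vs))\<^sup>2)"
    using scalar_product_wedge_wedge[of vs "cnj_vec v" "cnj_vec (ext_prod vs)" v, OF assms]
    by (simp only: scalar_product_cnj_vec_self of_real_mult flip: cnj_vec_wedge)
  then have "(norm (wedge v (ext_prod vs)))\<^sup>2 = (norm v * norm (ext_prod vs))\<^sup>2"
    by (simp only: of_real_eq_iff power_mult_distrib)
  then show ?thesis
    by (simp add: power2_eq_iff_nonneg)
qed

lemma norm_wedge_orthogonal_real:
  fixes v :: "real ^ 'i::finite"
  assumes "\<And>w. w \<in> set vs \<Longrightarrow> v \<bullet> w = 0"
  shows "norm (wedge v (ext_prod vs)) = norm v * norm (ext_prod vs)"
proof -
  have "scalar_product v w = 0" if "w \<in> set vs" for w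
    using assms[OF that] by (simp add: scalar_product_def inner_vec_def)
  then have "(norm (wedge v (ext_prod vs)))\<^sup>2 = (norm v * norm (ext_prod vs))\<^sup>2"
    using scalar_product_wedge_wedge[of vs v "ext_prod vs" v]
    by (simp add: scalar_product_real_self power_mult_distrib)
  then show ?thesis
    by (simp add: power2_eq_iff_nonneg)
qed

section \<open>The underlying real space\<close>

text \<open>
  Linearity is over the reals also on the complex side: kernels and spans are compared as real
  subspaces, so that one orthogonal decomposition of
  \<open>\<complex>\<^sup>n\<close> as a Euclidean space serves both sides.
\<close>

lemma linear_wedge_complex: "linear (\<lambda>w. wedge w x)" for x :: "(complex, 'i::finite) grassmann"
  by (rule linearI) (simp_all add: vec_eq_iff wedge_nth algebra_simps sum.distrib scaleR_sum_right)

lemma linear_wedge_real: "linear (\<lambda>w. wedge w x)" for x :: "(real, 'i::finite) grassmann"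
  by (rule linearI) (simp_all add: vec_eq_iff wedge_nth algebra_simps sum.distrib sum_distrib_left)

lemma linear_ii_smult: "linear (\<lambda>w :: complex ^ 'n::finite. \<i> *s w)"
  by (rule linearI) (simp_all add: vec_eq_iff algebra_simps)

lemma realify_inner: "realify v \<bullet> realify w = v \<bullet> w" for v w :: "complex ^ 'n::finite"
  unfolding inner_realify by (simp add: inner_vec_def inner_complex_def)

lemma norm_realify: "norm (realify v) = norm v" for v :: "complex ^ 'n::finite"
  by (simp add: norm_eq_sqrt_inner realify_inner)

lemma norm_ii_smult: "norm (\<i> *s v) = norm v" for v :: "complex ^ 'n::finite"
  by (simp add: norm_vec_def norm_mult)

lemma ii_smult_ii_smult: "\<i> *s (\<i> *s v) = - v" for v :: "complex ^ 'n::finite"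
  by (simp add: vec_eq_iff)

lemma inner_ii_smult: "(\<i> *s v) \<bullet> w = - (v \<bullet> (\<i> *s w))" for v w :: "complex ^ 'n::finite"
  by (simp add: inner_vec_def inner_complex_def sum_negf[symmetric] algebra_simps)

lemma inner_ii_smult_self: "v \<bullet> (\<i> *s v) = 0" for v :: "complex ^ 'n::finite"
  by (simp add: inner_vec_def inner_complex_def algebra_simps)

text \<open>
  The imaginary part of the Hermitian product is again a real product, so being orthogonal in the
  real sense to \<open>w\<close> and to \<open>\<i>w\<close> is the same as being Hermitian orthogonal to \<open>w\<close>.
\<close>

lemma scalar_product_cnj_vec_conv_inner:
  "scalar_product (cnj_vec v) w = Complex (v \<bullet> w) (- (v \<bullet> (\<i> *s w)))" for v w :: "complex ^ 'n::finite"
  by (simp add: complex_eq_iff scalar_product_def cnj_vec_def inner_vec_def inner_complex_def algebra_simps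
      flip: sum_negf)

abbreviation real_frame :: "(complex ^ 'n::finite) list \<Rightarrow> (real ^ ('n + 'n)) list" where
  "real_frame vs \<equiv> concat (map (\<lambda>v. [realify v, realify (\<i> *s v)]) vs)"

section \<open>Comparison of the two norms\<close>

text \<open>
  The real span of the \<open>u\<close> and \<open>\<i>u\<close> is the complex span of the \<open>u\<close>, and the multiples \<open>\<i>u\<close> too
  annihilate the product, by complex linearity.
\<close>

lemma wedge_ext_prod_span:
  fixes vs :: "(complex ^ 'n::finite) list"
  assumes "y \<in> span (set vs \<union> (\<lambda>u. \<i> *s u) ` set vs)"
  shows "wedge y (ext_prod vs) = 0"
proof (rule linear_eq_0_on_span[OF linear_wedge_complex _ assms])
  fix w assume "w \<in> set vs \<union> (\<lambda>u. \<i> *s u) ` set vs"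
  then obtain u where u: "u \<in> set vs" and w: "w = u \<or> w = \<i> *s u" by blast
  have "wedge (\<i> *s u) (ext_prod vs) = \<i> *s wedge u (ext_prod vs)"
    by (simp add: vec_eq_iff wedge_nth sum_distrib_left mult_ac)
  then show "wedge w (ext_prod vs) = 0"
    using w wedge_ext_prod_member[OF u] by auto
qed

lemma set_real_frame:
  "set (real_frame vs) = realify ` (set vs \<union> (\<lambda>u. \<i> *s u) ` set vs)"
  by (auto simp: image_iff)

text \<open>
  On the real side \<open>u\<close> and \<open>\<i>u\<close> are both factors of the product, which is why the same span
  annihilates it.
\<close>

lemma wedge_ext_prod_real_frame_span:
  fixes vs :: "(complex ^ 'n::finite) list"
  assumes "y \<in> span (set vs \<union> (\<lambda>u. \<i> *s u) ` set vs)"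
  shows "wedge (realify y) (ext_prod (real_frame vs)) = 0"
proof (rule linear_eq_0_on_span[OF _ _ assms])
  show "linear (\<lambda>w. wedge (realify w) (ext_prod (real_frame vs)))"
    using linear_compose[OF linear_realify linear_wedge_real] by (simp add: o_def)
next
  fix w assume "w \<in> set vs \<union> (\<lambda>u. \<i> *s u) ` set vs"
  then have "realify w \<in> set (real_frame vs)"
    unfolding set_real_frame by (rule imageI)
  then show "wedge (realify w) (ext_prod (real_frame vs)) = 0"
    by (rule wedge_ext_prod_member)
qed

lemma span_ii_smult:
  fixes S :: "(complex ^ 'n::finite) set"
  assumes "y \<in> span (S \<union> (\<lambda>u. \<i> *s u) ` S)"
  shows "\<i> *s y \<in> span (S \<union> (\<lambda>u. \<i> *s u) ` S)" (is "_ \<in> span ?T")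
proof -
  have "\<i> *s y \<in> span ((\<lambda>u. \<i> *s u) ` ?T)"
    using assms by (simp add: linear_span_image[OF linear_ii_smult])
  moreover have "(\<lambda>u. \<i> *s u) ` ?T \<subseteq> span ?T"
    by (auto simp: ii_smult_ii_smult intro: span_base span_neg[OF span_base])
  ultimately show ?thesis
    using span_minimal subspace_span by blast
qed

text \<open>
  Induction along the list: with \<open>z\<close> the part of the new vector orthogonal to the others, both sides
  acquire the factor \<open>(norm z)\<^sup>2\<close>.
\<close>

lemma norm_ext_prod_real_frame:
  "(norm (ext_prod vs))\<^sup>2 = norm (ext_prod (real_frame vs))"
  for vs :: "(complex ^ 'n::finite) list"
proof (induction vs)
  case Nil
  show ?case
    by (simp add: ext_one_def norm_axis_1)
next
  case (Cons v vs)
  define S where "S = set vs \<union> (\<lambda>u. \<i> *s u) ` set vs"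
  define R where "R = ext_prod (real_frame vs)"
  obtain y z where y: "y \<in> span S" and orth: "\<And>w. w \<in> span S \<Longrightarrow> orthogonal z w" and v: "v = y + z"
    using orthogonal_subspace_decomp_exists[of S v] by blast
  have z: "z \<bullet> w = 0" "z \<bullet> (\<i> *s w) = 0" if "w \<in> S" for w
    using orth[of w] orth[of "\<i> *s w"] span_base[OF that] span_ii_smult[of w "set vs"]
    by (auto simp: orthogonal_def S_def)

  have "norm (ext_prod (v # vs)) = norm (wedge z (ext_prod vs))"
    using wedge_ext_prod_span[of y vs] y by (simp add: v wedge_add_left S_def)
  also have "\<dots> = norm z * norm (ext_prod vs)"
    by (rule norm_wedge_orthogonal_complex)
      (use z in \<open>simp add: scalar_product_cnj_vec_conv_inner S_def complex_eq_iff\<close>)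
  finally have complex: "norm (ext_prod (v # vs)) = norm z * norm (ext_prod vs)" .

  have split: "realify v = realify y + realify z" "realify (\<i> *s v) = realify (\<i> *s y) + realify (\<i> *s z)"
    by (simp_all add: v linear_add[OF linear_realify] linear_add[OF linear_ii_smult])
  have kill: "wedge (realify y) R = 0" "wedge (realify (\<i> *s y)) R = 0"
    using y wedge_ext_prod_real_frame_span span_ii_smult unfolding R_def S_def by blast+
  \<comment> \<open>The component \<open>y\<close> of \<open>v\<close> can only be dropped next to \<open>R\<close>, so the first two factors are
    swapped and then swapped back.\<close>
  have "ext_prod (real_frame (v # vs)) = wedge (realify v) (wedge (realify (\<i> *s z)) R)"
    using kill by (simp add: split(2) wedge_add_left R_def)
  also have "\<dots> = - wedge (realify (\<i> *s z)) (wedge (realify v) R)"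
    by (rule wedge_anticommute)
  also have "wedge (realify v) R = wedge (realify z) R"
    using kill by (simp add: split(1) wedge_add_left)
  also have "- wedge (realify (\<i> *s z)) (wedge (realify z) R) =
      wedge (realify z) (ext_prod (realify (\<i> *s z) # real_frame vs))"
    by (simp add: R_def wedge_anticommute[of "realify z"])
  finally have "norm (ext_prod (real_frame (v # vs))) =
      norm (wedge (realify z) (ext_prod (realify (\<i> *s z) # real_frame vs)))"
    by simp
  also have "\<dots> = norm z * norm (ext_prod (realify (\<i> *s z) # real_frame vs))"
  proof (subst norm_wedge_orthogonal_real)
    fix w assume "w \<in> set (realify (\<i> *s z) # real_frame vs)"
    then consider "w = realify (\<i> *s z)" | u where "u \<in> S" "w = realify u"
      using set_real_frame[of vs] unfolding S_def by auto
    then show "realify z \<bullet> w = 0"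
      using z by cases (simp_all add: realify_inner inner_ii_smult_self)
  qed (simp add: norm_realify)
  also have "norm (ext_prod (realify (\<i> *s z) # real_frame vs)) = norm z * norm R"
    unfolding ext_prod_Cons R_def
  proof (subst norm_wedge_orthogonal_real)
    fix w assume "w \<in> set (real_frame vs)"
    then obtain u where "u \<in> S" "w = realify u"
      unfolding set_real_frame S_def by blast
    then show "realify (\<i> *s z) \<bullet> w = 0"
      using z by (simp add: realify_inner inner_ii_smult)
  qed (simp add: norm_realify norm_ii_smult)
  finally show ?case
    unfolding complex R_def Cons.IH[symmetric] by (simp add: power2_eq_square)
qed

theorem corollary4p2:
  fixes v :: "nat \<Rightarrow> complex ^ 'n" and p :: nat
  shows "(norm (ext_prod (map v [1..<Suc p])))\<^sup>2 =
    norm (ext_prod (concat (map (\<lambda>k. [realify (v k), realify (\<i> *s v k)]) [1..<Suc p])))"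
  using norm_ext_prod_real_frame[of "map v [1..<Suc p]"] by (simp only: map_map o_def)

end
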